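(* Let $L$ be a continuous conditionally-complete distributive lattice, let $E$ be a metrizable topological space with Borel $\sigma$-algebra $\mathcal{B}$, and let $\nu:\mathcal{B}\to L$ be an $L$-valued optimal measure. Then $\nu$ can be decomposed as $$\nu = \lfloor\nu\rfloor\oplus\bot\nu,$$ where $\lfloor\nu\rfloor$ (the regular part of $\nu$) is a regular optimal measure and $\bot\nu$ (the singular part of $\nu$) is an optimal measure satisfying $\bot\nu(K)=0$ for all compact subsets $K$ of $E$.
   Context: Order theory. $\bigoplus$, $\oplus$ denote suprema, $\bigwedge$ infima. A lattice is a poset in which every nonempty finite subset has a supremum and an infimum; it is conditionally-complete if every nonempty subset bounded above has a supremum; it is distributive if finite infima distribute over finite suprema. A filter in a poset is a nonempty upper set $F$ in which any two elements have a lower bound in $F$. $s \gg r$ means: for every filter $F$ having an infimum, $r \geqslant \bigwedge F$ implies $s\in F$. A poset $L$ is continuous if for every $r\in L$ the set $\{s : s\gg r\}$ is a filter with infimum $r$. $L$ is assumed to have a bottom element $0$ (so every filter of $L$ has an infimum). Measures. $\mathcal{B}$ is the usual Borel $\sigma$-algebra of the metrizable space $E$, $\mathcal{G}$ its open subsets, $\mathcal{K}$ its compact subsets. A map $\nu:\mathcal{B}\to L$ is a maxitive measure (resp. $\sigma$-maxitive measure) if $\nu(\emptyset)=0$ and for every finite (resp. countable) family $(B_j)$ in $\mathcal{B}$, the supremum of the $\nu(B_j)$ exists and equals $\nu(\bigcup_j B_j)$. It is continuous from above if $\nu(\bigcap_n B_n)=\bigwedge_n\nu(B_n)$ for every nonincreasing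 sequence $B_1\supset B_2\supset\cdots$ in $\mathcal{B}$. An optimal measure is a continuous from above $\sigma$-maxitive measure. $\nu^{+}(B) := \bigwedge_{G\in\mathcal{G}, G\supset B}\nu(G)$ for $B\in\mathcal{B}$. $\nu$ is regular if for all $B\in\mathcal{B}$ both $\nu(B)=\bigoplus_{K\in\mathcal{K},K\subset B}\nu(K)$ and $\nu(B)=\nu^{+}(B)$. The regular part of $\nu$ is $\lfloor\nu\rfloor(B) := \bigoplus_{K\in\mathcal{K}, K\subset B}\nu^{+}(K)$, $B\in\mathcal{B}$. The singular part $\bot\nu$ is the least (for the pointwise order) $L$-valued maxitive measure on $\mathcal{B}$ such that $\nu^{+}=\lfloor\nu\rfloor\oplus\bot\nu$ (it exists under the present assumptions). *)

theory Defs
  imports "HOL-Analysis.Analysis" "HOL-Library.Lub_Glb"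
begin

section \<open>Continuous posets\<close>

definition poset_filter :: "'l::order set \<Rightarrow> bool" where
  "poset_filter F \<longleftrightarrow> F \<noteq> {} \<and> (\<forall>x\<in>F. \<forall>y. x \<le> y \<longrightarrow> y \<in> F)
     \<and> (\<forall>x\<in>F. \<forall>y\<in>F. \<exists>z\<in>F. z \<le> x \<and> z \<le> y)"

definition way_above :: "'l::order \<Rightarrow> 'l \<Rightarrow> bool"  (infix \<open>\<ggreater>\<close> 50) where
  "s \<ggreater> r \<longleftrightarrow> (\<forall>F m. poset_filter F \<and> isGlb UNIV F m \<and> m \<le> r \<longrightarrow> s \<in> F)"

definition continuous_poset :: "'l::order itself \<Rightarrow> bool" where
  "continuous_poset (_ :: 'l itself) \<longleftrightarrow>
     (\<forall>r::'l. poset_filter {s. s \<ggreater> r} \<and> isGlb UNIV {s. s \<ggreater> r} r)"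

section \<open>Maxitive measures\<close>

text \<open>A map on the Borel sets is represented by a total function on sets. Its values on
  non-Borel sets are irrelevant: every notion below only looks at Borel sets.

  A finite or countable family of Borel sets is given by the set of its members, since the
  supremum of the values and the union depend on nothing else. \<^term>\<open>isLub UNIV\<close> states that
  the supremum exists and has the given value (the library's \<^term>\<open>Sup\<close> is
  unspecified on empty and on unbounded sets).\<close>

definition maxitive_measure ::
    "('e::topological_space set \<Rightarrow> 'l::{conditionally_complete_lattice, order_bot}) \<Rightarrow> bool" where
  "maxitive_measure \<nu> \<longleftrightarrow> \<nu> {} = bot
     \<and> (\<forall>\<A>. finite \<A> \<and> \<A> \<subseteq> sets borel \<longrightarrow> isLub UNIV (\<nu> ` \<A>) (\<nu> (\<Union>\<A>)))"

definition sigma_maxitive_measure ::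
    "('e::topological_space set \<Rightarrow> 'l::{conditionally_complete_lattice, order_bot}) \<Rightarrow> bool" where
  "sigma_maxitive_measure \<nu> \<longleftrightarrow> \<nu> {} = bot
     \<and> (\<forall>\<A>. countable \<A> \<and> \<A> \<subseteq> sets borel \<longrightarrow> isLub UNIV (\<nu> ` \<A>) (\<nu> (\<Union>\<A>)))"

text \<open>Infima may be written with \<^term>\<open>Inf\<close>: all the sets concerned are nonempty, and bounded
  below by \<^term>\<open>bot\<close>.\<close>

definition continuous_from_above ::
    "('e::topological_space set \<Rightarrow> 'l::{conditionally_complete_lattice, order_bot}) \<Rightarrow> bool" where
  "continuous_from_above \<nu> \<longleftrightarrow>
     (\<forall>B::nat \<Rightarrow> 'e set. range B \<subseteq> sets borel \<and> decseq B \<longrightarrow> \<nu> (\<Inter>n. B n) = (INF n. \<nu> (B n)))"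

definition optimal_measure ::
    "('e::topological_space set \<Rightarrow> 'l::{conditionally_complete_lattice, order_bot}) \<Rightarrow> bool" where
  "optimal_measure \<nu> \<longleftrightarrow> sigma_maxitive_measure \<nu> \<and> continuous_from_above \<nu>"

definition outer_part ::
    "('e::topological_space set \<Rightarrow> 'l::{conditionally_complete_lattice, order_bot}) \<Rightarrow> 'e set \<Rightarrow> 'l" where
  "outer_part \<nu> B = (INF G\<in>{G. open G \<and> B \<subseteq> G}. \<nu> G)"

definition regular_measure ::
    "('e::topological_space set \<Rightarrow> 'l::{conditionally_complete_lattice, order_bot}) \<Rightarrow> bool" where
  "regular_measure \<nu> \<longleftrightarrow>
     (\<forall>B\<in>sets borel. isLub UNIV (\<nu> ` {K. compact K \<and> K \<subseteq> B}) (\<nu> B) \<and> \<nu> B = outer_part \<nu> B)"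

text \<open>If \<open>\<nu>\<close> is maxitive, hence monotone on Borel sets, the set below is bounded above by
  \<^term>\<open>\<nu> UNIV\<close>, so that \<^term>\<open>Sup\<close> is its supremum.\<close>

definition regular_part ::
    "('e::topological_space set \<Rightarrow> 'l::{conditionally_complete_lattice, order_bot}) \<Rightarrow> 'e set \<Rightarrow> 'l" where
  "regular_part \<nu> B = (SUP K\<in>{K. compact K \<and> K \<subseteq> B}. outer_part \<nu> K)"

text \<open>\<^term>\<open>Least\<close> refers to the pointwise order on total functions. As the predicate only
  constrains the values on Borel sets, the least such function is the least one on the Borel
  sets, extended by \<^term>\<open>bot\<close> to the other sets.\<close>

definition singular_part ::
    "('e::topological_space set \<Rightarrow> 'l::{conditionally_complete_lattice, order_bot}) \<Rightarrow> 'e set \<Rightarrow> 'l" where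
  "singular_part \<nu> = (LEAST \<tau>. maxitive_measure \<tau>
     \<and> (\<forall>B\<in>sets borel. outer_part \<nu> B = sup (regular_part \<nu> B) (\<tau> B)))"

end

theory Submission
  imports Defs
begin

text \<open>Continuity makes suprema distribute over filtered infima. As in classical measure theory,
  every Borel set \<open>B\<close> lies between a closed \<open>F\<close> and an open \<open>G\<close> with \<open>\<nu> (G - F)\<close> below any
  prescribed \<open>s \<ggreater> 0\<close>; hence the outer part of \<open>\<nu>\<close> is \<open>\<nu>\<close> itself, and \<open>\<nu>\<close> is inner regular
  for closed sets. Closed subsets of compact sets being compact, \<open>\<nu>\<close> and its regular part \<open>\<rho>\<close>
  agree on the Borel subsets of compact sets, which makes \<open>\<rho>\<close> \<open>\<sigma>\<close>-maxitive and regular.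
  By distributivity there is a least \<open>a \<setminus> c\<close> among the \<open>t\<close> with \<open>a \<le> c \<squnion> t\<close>, and the singular part
  of \<open>B\<close> is the supremum of \<open>\<nu> C \<setminus> \<rho> C\<close> over the Borel \<open>C \<subseteq> B\<close>. Both parts are \<open>\<sigma>\<close>-maxitive
  and dominated by \<open>\<nu>\<close>, and this is enough to inherit continuity from above.\<close>

section \<open>Continuous posets\<close>

lemma isGlb_UNIV_iff:
  "isGlb UNIV S m \<longleftrightarrow> (\<forall>x\<in>S. m \<le> x) \<and> (\<forall>z. (\<forall>x\<in>S. z \<le> x) \<longrightarrow> z \<le> m)"
  by (simp add: isGlb_def greatestP_def isLb_def setge_def setle_def)

lemma isLub_UNIV_iff:
  "isLub UNIV S m \<longleftrightarrow> (\<forall>x\<in>S. x \<le> m) \<and> (\<forall>z. (\<forall>x\<in>S. x \<le> z) \<longrightarrow> m \<le> z)"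
  by (simp add: isLub_def leastP_def isUb_def setge_def setle_def)

text \<open>The upper closure of a downward directed \<open>D\<close> is a filter with the same
  infimum, so it contains \<open>s\<close>; this frees later arguments from upward closed
  sets.\<close>

lemma way_above_directedD:
  assumes "s \<ggreater> r" and "D \<noteq> {}"
    and directed: "\<And>x y. x \<in> D \<Longrightarrow> y \<in> D \<Longrightarrow> \<exists>z\<in>D. z \<le> x \<and> z \<le> y"
    and "isGlb UNIV D m" "m \<le> r"
  shows "\<exists>d\<in>D. d \<le> s"
proof -
  let ?F = "{x. \<exists>d\<in>D. d \<le> x}"
  have "poset_filter ?F"
    unfolding poset_filter_def
  proof (intro conjI ballI allI impI)
    show "?F \<noteq> {}" using \<open>D \<noteq> {}\<close> by auto
  next
    fix x y assume "x \<in> ?F" "x \<le> y"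
    then show "y \<in> ?F" by (auto intro: order_trans)
  next
    fix x y assume "x \<in> ?F" "y \<in> ?F"
    then obtain c d where "c \<in> D" "c \<le> x" "d \<in> D" "d \<le> y" by auto
    moreover from directed[OF \<open>c \<in> D\<close> \<open>d \<in> D\<close>] obtain e where "e \<in> D" "e \<le> c" "e \<le> d" by auto
    ultimately show "\<exists>z\<in>?F. z \<le> x \<and> z \<le> y" by (intro bexI[of _ e]) auto
  qed
  moreover have "isGlb UNIV ?F m"
    using \<open>isGlb UNIV D m\<close> unfolding isGlb_UNIV_iff by (blast intro: order_trans)
  ultimately have "s \<in> ?F"
    using \<open>s \<ggreater> r\<close> \<open>m \<le> r\<close> unfolding way_above_def by blast
  then show ?thesis by simp
qed

lemma way_above_antimono: "s \<ggreater> t \<Longrightarrow> r \<le> t \<Longrightarrow> s \<ggreater> r"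
  unfolding way_above_def by (blast intro: order_trans)

context
  assumes continuous: "continuous_poset TYPE('l::order)"
begin

lemma way_above_filter: "poset_filter {s::'l. s \<ggreater> r}"
  using continuous by (simp add: continuous_poset_def)

lemma way_above_isGlb: "isGlb UNIV {s::'l. s \<ggreater> r} r"
  using continuous by (simp add: continuous_poset_def)

lemma way_above_directed:
  assumes "s \<ggreater> (r::'l)" "t \<ggreater> r"
  obtains u where "u \<ggreater> r" "u \<le> s" "u \<le> t"
proof -
  have "\<exists>u\<in>{s. s \<ggreater> r}. u \<le> s \<and> u \<le> t"
    using way_above_filter[of r] assms by (simp add: poset_filter_def)
  with that show thesis by auto
qed

lemma way_above_up: "s \<ggreater> (r::'l) \<Longrightarrow> s \<le> t \<Longrightarrow> t \<ggreater> r"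
  using way_above_filter[of r] unfolding poset_filter_def by blast

lemma way_above_nonempty: "{s::'l. s \<ggreater> r} \<noteq> {}"
  using way_above_filter[of r] unfolding poset_filter_def by blast

lemma way_above_imp_ge: "s \<ggreater> (r::'l) \<Longrightarrow> r \<le> s"
  using way_above_isGlb[of r] unfolding isGlb_UNIV_iff by blast

lemma le_if_le_way_above:
  assumes "\<And>s. s \<ggreater> (r::'l) \<Longrightarrow> z \<le> s"
  shows "z \<le> r"
  using assms way_above_isGlb[of r] unfolding isGlb_UNIV_iff by blast

text \<open>The elements way above something that is itself way above \<open>r\<close> form a
  directed set with infimum \<open>r\<close>, so one of them lies below \<open>s\<close>.
  Interpolation plays the part of choosing a smaller epsilon.\<close>

lemma way_above_interpolate:
  assumes "s \<ggreater> (r::'l)"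
  obtains t where "s \<ggreater> t" "t \<ggreater> r"
proof -
  let ?D = "{u. \<exists>t. u \<ggreater> t \<and> t \<ggreater> r}"
  have "\<exists>d\<in>?D. d \<le> s"
  proof (rule way_above_directedD[OF assms, where m = r])
    from way_above_nonempty obtain t where "t \<ggreater> r" by auto
    moreover from way_above_nonempty obtain u where "u \<ggreater> t" by auto
    ultimately show "?D \<noteq> {}" by auto
  next
    fix x y assume "x \<in> ?D" "y \<in> ?D"
    then obtain a b where a: "x \<ggreater> a" "a \<ggreater> r" and b: "y \<ggreater> b" "b \<ggreater> r" by auto
    obtain c where c: "c \<ggreater> r" "c \<le> a" "c \<le> b"
      using way_above_directed[OF a(2) b(2)] .
    \<comment> \<open>Replacing \<open>a\<close> and \<open>b\<close> by a common lower
      \<open>c\<close> puts \<open>x\<close> and \<open>y\<close> way above the same element, where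
      directedness applies.\<close>
    have "x \<ggreater> c" "y \<ggreater> c"
      using a(1) b(1) c by (auto intro: way_above_antimono)
    then obtain u where "u \<ggreater> c" "u \<le> x" "u \<le> y"
      by (rule way_above_directed)
    with c(1) show "\<exists>z\<in>?D. z \<le> x \<and> z \<le> y" by blast
  next
    show "isGlb UNIV ?D r"
      unfolding isGlb_UNIV_iff
    proof (intro conjI ballI allI impI)
      fix u assume "u \<in> ?D"
      then show "r \<le> u" by (auto dest!: way_above_imp_ge intro: order_trans)
    next
      fix z assume z: "\<forall>u\<in>?D. z \<le> u"
      show "z \<le> r"
      \<comment> \<open>Continuity is used twice: at \<open>t\<close>, whose way-above elements all
        lie in the set, and then at \<open>r\<close>, by varying \<open>t\<close>.\<close>
      proof (rule le_if_le_way_above)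
        fix t assume "t \<ggreater> r"
        with z show "z \<le> t" by (intro le_if_le_way_above[of t]) blast
      qed
    qed
  qed simp
  then show thesis using that way_above_up by blast
qed

end

section \<open>Suprema and filtered infima\<close>

text \<open>Any \<open>s\<close> way above \<open>sup x (Inf D)\<close> dominates \<open>x\<close>
  and, \<open>D\<close> being directed, also some \<open>d\<close> in \<open>D\<close>; hence it
  dominates \<open>sup x d\<close> and thus \<open>z\<close>. Since \<open>sup x (Inf D)\<close> is
  the infimum of all such \<open>s\<close>, the bound passes to it.\<close>

lemma le_sup_Inf_directed:
  fixes D :: "'l::{conditionally_complete_lattice, order_bot} set"
  assumes cont: "continuous_poset TYPE('l)" and "D \<noteq> {}"
    and directed: "\<And>x y. x \<in> D \<Longrightarrow> y \<in> D \<Longrightarrow> \<exists>z\<in>D. z \<le> x \<and> z \<le> y"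
    and le: "\<And>d. d \<in> D \<Longrightarrow> z \<le> sup x d"
  shows "z \<le> sup x (Inf D)"
proof (rule le_if_le_way_above[OF cont])
  fix s assume s: "s \<ggreater> sup x (Inf D)"
  have "isGlb UNIV D (Inf D)"
    using \<open>D \<noteq> {}\<close> by (auto simp: isGlb_UNIV_iff intro: cInf_lower cInf_greatest)
  with s \<open>D \<noteq> {}\<close> directed have "\<exists>d\<in>D. d \<le> s"
    by (rule way_above_directedD[OF _ _ _ _ sup_ge2])
  then obtain d where "d \<in> D" "d \<le> s" by blast
  moreover have "x \<le> s"
    using way_above_imp_ge[OF cont s] by simp
  ultimately show "z \<le> s"
    using le[of d] by (blast intro: order_trans le_supI)
qed

lemma le_sup_INF_decseq:
  fixes f :: "nat \<Rightarrow> 'l::{conditionally_complete_lattice, order_bot}"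
  assumes "continuous_poset TYPE('l)" "decseq f" "\<And>n. z \<le> sup x (f n)"
  shows "z \<le> sup x (INF n. f n)"
proof (rule le_sup_Inf_directed[OF assms(1)])
  fix a b assume "a \<in> range f" "b \<in> range f"
  then obtain m n where "a = f m" "b = f n" by auto
  then show "\<exists>c\<in>range f. c \<le> a \<and> c \<le> b"
    using \<open>decseq f\<close> by (intro bexI[of _ "f (max m n)"]) (auto simp: decseq_def)
qed (use assms(3) in auto)

lemma le_if_le_sup_way_above_bot:
  fixes x :: "'l::{conditionally_complete_lattice, order_bot}"
  assumes cont: "continuous_poset TYPE('l)" and le: "\<And>s. s \<ggreater> (bot::'l) \<Longrightarrow> z \<le> sup x s"
  shows "z \<le> x"
proof -
  have "z \<le> sup x (Inf {s. s \<ggreater> bot})"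
  proof (rule le_sup_Inf_directed[OF cont way_above_nonempty[OF cont]])
    fix s t :: 'l assume "s \<in> {s. s \<ggreater> bot}" "t \<in> {s. s \<ggreater> bot}"
    then obtain u where "u \<ggreater> bot" "u \<le> s" "u \<le> t"
      using way_above_directed[OF cont] by blast
    then show "\<exists>u\<in>{s. s \<ggreater> bot}. u \<le> s \<and> u \<le> t" by blast
  qed (use le in simp)
  moreover have "Inf {s. s \<ggreater> bot} = (bot::'l)"
    by (rule antisym[OF le_if_le_way_above[OF cont] bot_least]) (auto intro: cInf_lower)
  ultimately show ?thesis by (simp add: sup_absorb1)
qed

section \<open>Relative differences in the value lattice\<close>

text \<open>This is co-Heyting subtraction, the order dual of Heyting implication. The set contains
  \<open>a\<close> and is bounded below by \<open>bot\<close>, so \<open>Inf\<close> is a true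
  infimum.\<close>

definition relative_difference ::
    "'l::{conditionally_complete_lattice, order_bot} \<Rightarrow> 'l \<Rightarrow> 'l" where
  "relative_difference a c = Inf {t. a \<le> sup c t}"

lemma relative_difference_le:
  "a \<le> sup c t \<Longrightarrow> relative_difference a c \<le> t"
  unfolding relative_difference_def by (rule cInf_lower) auto

text \<open>By distributivity the admissible \<open>t\<close> are closed under binary
  \<open>inf\<close>, hence directed, so their infimum is again admissible and is the least such
  \<open>t\<close>.\<close>

lemma le_sup_relative_difference:
  fixes a :: "'l::{conditionally_complete_lattice, distrib_lattice, order_bot}"
  assumes "continuous_poset TYPE('l)"
  shows "a \<le> sup c (relative_difference a c)"
  unfolding relative_difference_def
proof (rule le_sup_Inf_directed[OF assms])
  show "{t. a \<le> sup c t} \<noteq> {}" by (auto intro: exI[of _ a])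
next
  fix x y assume "x \<in> {t. a \<le> sup c t}" "y \<in> {t. a \<le> sup c t}"
  then show "\<exists>z\<in>{t. a \<le> sup c t}. z \<le> x \<and> z \<le> y"
    by (intro bexI[of _ "inf x y"]) (auto simp: sup_inf_distrib1)
qed simp

section \<open>Maxitive measures\<close>

lemma maxitive_measure_mono:
  assumes "maxitive_measure \<nu>" "A \<in> sets borel" "B \<in> sets borel" "A \<subseteq> B"
  shows "\<nu> A \<le> \<nu> B"
proof -
  have "isLub UNIV (\<nu> ` {A, B}) (\<nu> (\<Union>{A, B}))"
    using assms(1-3) unfolding maxitive_measure_def
    by (elim conjE allE[of _ "{A, B}"]) simp
  moreover have "\<Union>{A, B} = B" using assms by auto
  ultimately show ?thesis by (simp add: isLub_UNIV_iff)
qed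

lemma sigma_maxitive_imp_maxitive: "sigma_maxitive_measure \<nu> \<Longrightarrow> maxitive_measure \<nu>"
  unfolding maxitive_measure_def sigma_maxitive_measure_def by (blast intro: countable_finite)

lemmas sigma_maxitive_mono = maxitive_measure_mono[OF sigma_maxitive_imp_maxitive]

lemma sigma_maxitive_Union_le:
  assumes "sigma_maxitive_measure \<nu>" "countable \<A>" "\<A> \<subseteq> sets borel" "\<And>A. A \<in> \<A> \<Longrightarrow> \<nu> A \<le> z"
  shows "\<nu> (\<Union>\<A>) \<le> z"
proof -
  have "isLub UNIV (\<nu> ` \<A>) (\<nu> (\<Union>\<A>))"
    using assms(1-3) by (simp add: sigma_maxitive_measure_def)
  with assms(4) show ?thesis by (simp add: isLub_UNIV_iff)
qed

lemma sigma_maxitive_Un_le: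
  assumes "sigma_maxitive_measure \<nu>" "A \<in> sets borel" "B \<in> sets borel"
  shows "\<nu> (A \<union> B) \<le> sup (\<nu> A) (\<nu> B)"
proof -
  have "\<nu> (\<Union>{A, B}) \<le> sup (\<nu> A) (\<nu> B)"
    by (rule sigma_maxitive_Union_le[OF assms(1)]) (use assms in auto)
  then show ?thesis by simp
qed

lemma sigma_maxitive_subset_Un_le:
  assumes "sigma_maxitive_measure \<nu>" "A \<in> sets borel" "B \<in> sets borel" "C \<in> sets borel"
    and "C \<subseteq> A \<union> B"
  shows "\<nu> C \<le> sup (\<nu> A) (\<nu> B)"
  by (rule order_trans[OF sigma_maxitive_mono[OF assms(1), of C "A \<union> B"]
        sigma_maxitive_Un_le[OF assms(1-3)]]) (use assms in auto)

text \<open>Monotonicity makes the value of the union an upper bound, the last premise makes it the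
  least one. With an arbitrary bound \<open>z\<close>, no supremum has to be computed.\<close>

lemma sigma_maxitiveI:
  assumes "\<nu> {} = bot"
    and mono: "\<And>A B. A \<in> sets borel \<Longrightarrow> B \<in> sets borel \<Longrightarrow> A \<subseteq> B \<Longrightarrow> \<nu> A \<le> \<nu> B"
    and Union: "\<And>\<A> z. countable \<A> \<Longrightarrow> \<A> \<subseteq> sets borel \<Longrightarrow> (\<And>A. A \<in> \<A> \<Longrightarrow> \<nu> A \<le> z)
      \<Longrightarrow> \<nu> (\<Union>\<A>) \<le> z"
  shows "sigma_maxitive_measure \<nu>"
  unfolding sigma_maxitive_measure_def isLub_UNIV_iff
proof (intro conjI allI impI ballI)
  fix \<A> x assume \<A>: "countable \<A> \<and> \<A> \<subseteq> sets borel" and "x \<in> \<nu> ` \<A>"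
  then obtain A where "A \<in> \<A>" "x = \<nu> A" by auto
  moreover have "\<Union>\<A> \<in> sets borel" using \<A> by (blast intro: sets.countable_Union)
  ultimately show "x \<le> \<nu> (\<Union>\<A>)" using \<A> mono[of A "\<Union>\<A>"] by blast
next
  fix \<A> z assume "countable \<A> \<and> \<A> \<subseteq> sets borel" "\<forall>x\<in>\<nu> ` \<A>. x \<le> z"
  then show "\<nu> (\<Union>\<A>) \<le> z" by (intro Union) blast+
qed (rule \<open>\<nu> {} = bot\<close>)

lemma continuous_from_aboveD:
  assumes "continuous_from_above \<nu>" "\<And>n::nat. B n \<in> sets borel" "decseq B"
  shows "\<nu> (\<Inter>n. B n) = (INF n. \<nu> (B n))"
  using assms by (simp add: continuous_from_above_def image_subset_iff)

text \<open>With \<open>A\<close> the limit of \<open>B n\<close>, maxitivity and domination give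
  \<open>\<mu> (B n) \<le> sup (\<mu> A) (\<nu> (B n - A))\<close>. The sets \<open>B n - A\<close>
  decrease to the empty set, so continuity of \<open>\<nu>\<close> sends the error to
  \<open>bot\<close>, and the infimum passes through \<open>sup\<close>.\<close>

lemma optimal_measure_of_dominated:
  fixes \<nu> \<mu> :: "'e::topological_space set \<Rightarrow> 'l::{conditionally_complete_lattice, order_bot}"
  assumes cont: "continuous_poset TYPE('l)" and \<nu>: "optimal_measure \<nu>"
    and \<mu>: "sigma_maxitive_measure \<mu>" and le: "\<And>B. B \<in> sets borel \<Longrightarrow> \<mu> B \<le> \<nu> B"
  shows "optimal_measure \<mu>"
  unfolding optimal_measure_def continuous_from_above_def
proof (intro conjI allI impI)
  fix B :: "nat \<Rightarrow> 'e set" assume "range B \<subseteq> sets borel \<and> decseq B"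
  then have B[measurable]: "\<And>n. B n \<in> sets borel" and dec: "decseq B" by auto
  define A where "A = (\<Inter>n. B n)"
  have A[measurable]: "A \<in> sets borel" unfolding A_def by measurable
  have decD: "decseq (\<lambda>n. B n - A)" using dec by (auto simp: decseq_def)
  have "(\<Inter>n. B n - A) = {}" by (auto simp: A_def)
  moreover have "\<nu> (\<Inter>n. B n - A) = (INF n. \<nu> (B n - A))"
    using \<nu> decD by (intro continuous_from_aboveD) (auto simp: optimal_measure_def)
  moreover have "\<nu> {} = bot"
    using \<nu> unfolding optimal_measure_def sigma_maxitive_measure_def by auto
  ultimately have inf0: "(INF n. \<nu> (B n - A)) = bot" by (simp only:)
  have "decseq (\<lambda>n. \<nu> (B n - A))"
    using decD \<nu> unfolding decseq_def optimal_measure_def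
    by (auto intro!: sigma_maxitive_mono)
  moreover have "(INF n. \<mu> (B n)) \<le> sup (\<mu> A) (\<nu> (B n - A))" for n
  proof -
    have "(INF n. \<mu> (B n)) \<le> \<mu> (B n)" by (rule cINF_lower) auto
    also have "\<dots> \<le> sup (\<mu> A) (\<mu> (B n - A))"
      by (rule sigma_maxitive_subset_Un_le[OF \<mu>]) auto
    also have "\<dots> \<le> sup (\<mu> A) (\<nu> (B n - A))" by (intro sup_mono le) auto
    finally show ?thesis .
  qed
  ultimately have "(INF n. \<mu> (B n)) \<le> sup (\<mu> A) (INF n. \<nu> (B n - A))"
    by (rule le_sup_INF_decseq[OF cont])
  moreover have "\<mu> A \<le> (INF n. \<mu> (B n))"
    by (rule cINF_greatest) (auto simp: A_def intro!: sigma_maxitive_mono[OF \<mu>])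
  ultimately show "\<mu> (\<Inter>n. B n) = (INF n. \<mu> (B n))"
    by (simp add: inf0 sup_absorb1 flip: A_def)
qed (rule \<mu>)

section \<open>Approximation by closed and open sets\<close>

lemma compact_imp_closed_metrizable:
  assumes "metrizable_space (euclidean :: 'e::topological_space topology)" "compact (K :: 'e set)"
  shows "closed K"
  using compactin_imp_closedin[OF metrizable_imp_Hausdorff_space[OF assms(1)], of K] assms(2)
  by simp

context
  fixes \<nu> :: "'e::topological_space set \<Rightarrow> 'l::{conditionally_complete_lattice, order_bot}"
  assumes continuous: "continuous_poset TYPE('l)"
    and metrizable: "metrizable_space (euclidean :: 'e topology)"
    and optimal: "optimal_measure \<nu>"
begin

lemma optimal_sigma_maxitive: "sigma_maxitive_measure \<nu>"
  using optimal by (simp add: optimal_measure_def)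

text \<open>The decreasing values have infimum \<open>\<nu> (\<Inter>n. B n)\<close>; being way
  above it forces one of them below \<open>s\<close> at a finite stage.\<close>

lemma optimal_eventually_le:
  assumes "\<And>n::nat. B n \<in> sets borel" "decseq B" "s \<ggreater> \<nu> (\<Inter>n. B n)"
  obtains n where "\<nu> (B n) \<le> s"
proof -
  have "decseq (\<lambda>n. \<nu> (B n))"
    using assms sigma_maxitive_mono[OF optimal_sigma_maxitive] by (auto simp: decseq_def)
  then have "s \<ggreater> (INF n. \<nu> (B n)) \<longrightarrow> (\<exists>d\<in>range (\<lambda>n. \<nu> (B n)). d \<le> s)"
    by (intro impI way_above_directedD[where m = "INF n. \<nu> (B n)"])
      (auto simp: isGlb_UNIV_iff decseq_def intro!: cINF_lower cINF_greatest intro: max.cobounded1 max.cobounded2)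
  with assms that continuous_from_aboveD[of \<nu> B] optimal show thesis
    by (auto simp: optimal_measure_def)
qed

lemma closed_open_approximation:
  assumes "B \<in> sets borel" "s \<ggreater> (bot::'l)"
  obtains F G where "closed F" "open G" "F \<subseteq> B" "B \<subseteq> G" "\<nu> (G - F) \<le> s"
proof -
  have bot: "\<nu> {} = bot"
    using optimal_sigma_maxitive by (simp add: sigma_maxitive_measure_def)
  have "B \<in> sigma_sets UNIV (Collect closed)"
    using assms(1) by (simp add: borel_eq_closed)
  \<comment> \<open>The tolerance is quantified inside the induction because the union case uses the
    hypothesis at a finer one.\<close>
  then have "\<forall>s. s \<ggreater> (bot::'l) \<longrightarrow>
    (\<exists>F G. closed F \<and> open G \<and> F \<subseteq> B \<and> B \<subseteq> G \<and> \<nu> (G - F) \<le> s)"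
  proof (induction rule: sigma_sets.induct)
    case (Basic B)
    \<comment> \<open>A closed set in a metrizable space is a decreasing limit of open sets; one of
      these serves as \<open>G\<close>, and \<open>B\<close> itself as \<open>F\<close>.\<close>
    then have "gdelta_in euclidean B"
      using closed_imp_gdelta_in[OF metrizable] by simp
    then obtain G where G: "\<And>n. open (G n)" "\<And>n. G (Suc n) \<subseteq> G n" "\<Inter>(range G) = B"
      unfolding gdelta_in_descending by auto
    have [measurable]: "G n \<in> sets borel" "B \<in> sets borel" for n
      using G(1) Basic by auto
    have dec: "decseq (\<lambda>n. G n - B)"
      using decseq_SucI[of G, OF G(2)] by (auto simp: decseq_def)
    show ?case
    proof (intro allI impI)
      fix s :: 'l assume "s \<ggreater> bot"
      moreover have "(\<Inter>n. G n - B) = {}" using G(3) by auto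
      ultimately have "s \<ggreater> \<nu> (\<Inter>n. G n - B)" by (simp only: bot)
      then obtain n where "\<nu> (G n - B) \<le> s"
        by (rule optimal_eventually_le[OF _ dec, rotated]) auto
      moreover have "B \<subseteq> G n" using G(3) by auto
      ultimately show "\<exists>F G. closed F \<and> open G \<and> F \<subseteq> B \<and> B \<subseteq> G \<and> \<nu> (G - F) \<le> s"
        using Basic G(1) by blast
    qed
  next
    case Empty
    show ?case
      by (intro allI impI exI[of _ "{}"]) (simp add: bot)
  next
    case (Compl B)
    show ?case
    proof (intro allI impI)
      fix s :: 'l assume "s \<ggreater> bot"
      from Compl.IH[rule_format, OF this]
      obtain F G where FG: "closed F" "open G" "F \<subseteq> B" "B \<subseteq> G" "\<nu> (G - F) \<le> s"
        by (elim exE conjE)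
      have "- F - (- G) = G - F" by auto
      with FG(5) have "\<nu> (- F - (- G)) \<le> s" by (simp only:)
      moreover have "closed (- G)" "open (- F)" "- G \<subseteq> UNIV - B" "UNIV - B \<subseteq> - F"
        using FG by auto
      ultimately show
        "\<exists>F G. closed F \<and> open G \<and> F \<subseteq> UNIV - B \<and> UNIV - B \<subseteq> G \<and> \<nu> (G - F) \<le> s"
        by blast
    qed
  next
    case (Union B)
    show ?case
    proof (intro allI impI)
      fix s :: 'l assume "s \<ggreater> bot"
      \<comment> \<open>One \<open>t\<close> serves for all \<open>n\<close>, as a countable union
        costs only a supremum. The gap between \<open>t\<close> and \<open>s\<close> pays for
        truncating the union of the \<open>F n\<close>, which must be finite to stay closed.\<close>
      then obtain t where t: "s \<ggreater> t" "t \<ggreater> bot"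
        by (rule way_above_interpolate[OF continuous])
      have "\<exists>F G. closed F \<and> open G \<and> F \<subseteq> B n \<and> B n \<subseteq> G \<and> \<nu> (G - F) \<le> t" for n
        using Union.IH[rule_format, OF t(2)] .
      then obtain F G where FG: "\<And>n. closed (F n)" "\<And>n. open (G n)" "\<And>n. F n \<subseteq> B n"
          "\<And>n. B n \<subseteq> G n" "\<And>n. \<nu> (G n - F n) \<le> t"
        by metis
      have [measurable]: "F n \<in> sets borel" "G n \<in> sets borel" for n
        using FG by auto
      \<comment> \<open>\<open>H n\<close> is the difference for the truncated union. These sets
        decrease to a subset of the union of all \<open>G n - F n\<close>, so their limit has value
        at most \<open>t\<close>.\<close>
      define H where "H n = (\<Union>m. G m) - (\<Union>m\<le>n. F m)" for n
      have [measurable]: "H n \<in> sets borel" for n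
        unfolding H_def by measurable
      have "decseq H" by (auto simp: H_def decseq_def)
      have "\<nu> (\<Inter>n. H n) \<le> \<nu> (\<Union>(range (\<lambda>n. G n - F n)))"
        by (intro sigma_maxitive_mono[OF optimal_sigma_maxitive]) (auto simp: H_def)
      also have "\<dots> \<le> t"
        by (rule sigma_maxitive_Union_le[OF optimal_sigma_maxitive]) (auto intro: FG(5))
      finally have "s \<ggreater> \<nu> (\<Inter>n. H n)"
        using t(1) by (rule way_above_antimono[rotated])
      then obtain n where "\<nu> (H n) \<le> s"
        using optimal_eventually_le[of H s] \<open>decseq H\<close> by auto
      then show "\<exists>F G. closed F \<and> open G \<and> F \<subseteq> \<Union>(range B) \<and> \<Union>(range B) \<subseteq> G \<and> \<nu> (G - F) \<le> s"
        using FG(2-4) closed_UN[OF finite_atMost, of n F] FG(1) unfolding H_def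
        by (intro exI[of _ "\<Union>m\<le>n. F m"] exI[of _ "\<Union>m. G m"]) blast
    qed
  qed
  from this[rule_format, OF assms(2)] that show thesis by (elim exE conjE)
qed

section \<open>Outer regularity, and inner regularity by closed sets\<close>

text \<open>An approximating open \<open>G\<close> is covered by \<open>B\<close> and
  \<open>G - F\<close>, so \<open>\<nu> G\<close> exceeds \<open>\<nu> B\<close> by at most the
  tolerance; the other inequality is monotonicity.\<close>

lemma outer_part_optimal:
  assumes B: "B \<in> sets borel"
  shows "outer_part \<nu> B = \<nu> B"
proof (rule antisym)
  show "outer_part \<nu> B \<le> \<nu> B"
  proof (rule le_if_le_sup_way_above_bot[OF continuous])
    fix s :: 'l assume "s \<ggreater> bot"
    with B obtain F G where FG: "closed F" "open G" "F \<subseteq> B" "B \<subseteq> G" "\<nu> (G - F) \<le> s"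
      by (rule closed_open_approximation)
    have "outer_part \<nu> B \<le> \<nu> G"
      unfolding outer_part_def by (rule cINF_lower) (use FG in auto)
    also have "\<dots> \<le> sup (\<nu> B) (\<nu> (G - F))"
      by (rule sigma_maxitive_subset_Un_le[OF optimal_sigma_maxitive]) (use FG B in auto)
    also have "\<dots> \<le> sup (\<nu> B) s" using FG(5) by (rule sup_mono[OF order_refl])
    finally show "outer_part \<nu> B \<le> sup (\<nu> B) s" .
  qed
  show "\<nu> B \<le> outer_part \<nu> B"
    unfolding outer_part_def
    by (rule cINF_greatest) (use B in \<open>auto intro!: sigma_maxitive_mono[OF optimal_sigma_maxitive]\<close>)
qed

text \<open>Here \<open>B\<close> is covered by an approximating closed \<open>F\<close> and the
  small set \<open>G - F\<close>. The least-bound form avoids naming a supremum.\<close>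

lemma optimal_le_if_closed_le:
  assumes B: "B \<in> sets borel" and le: "\<And>F. closed F \<Longrightarrow> F \<subseteq> B \<Longrightarrow> \<nu> F \<le> z"
  shows "\<nu> B \<le> z"
proof (rule le_if_le_sup_way_above_bot[OF continuous])
  fix s :: 'l assume "s \<ggreater> bot"
  with B obtain F G where FG: "closed F" "open G" "F \<subseteq> B" "B \<subseteq> G" "\<nu> (G - F) \<le> s"
    by (rule closed_open_approximation)
  have "\<nu> B \<le> sup (\<nu> F) (\<nu> (G - F))"
    by (rule sigma_maxitive_subset_Un_le[OF optimal_sigma_maxitive]) (use FG B in auto)
  also have "\<dots> \<le> sup z s" by (intro sup_mono le FG)
  finally show "\<nu> B \<le> sup z s" .
qed

section \<open>The regular part\<close>

lemma compact_in_borel: "compact (K :: 'e set) \<Longrightarrow> K \<in> sets borel"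
  by (rule borel_closed[OF compact_imp_closed_metrizable[OF metrizable]])

lemma regular_part_eq_SUP: "regular_part \<nu> B = (SUP K\<in>{K. compact K \<and> K \<subseteq> B}. \<nu> K)"
  unfolding regular_part_def by (rule SUP_cong) (auto simp: outer_part_optimal compact_in_borel)

lemma regular_part_upper:
  assumes "compact K" "K \<subseteq> B"
  shows "\<nu> K \<le> regular_part \<nu> B"
  unfolding regular_part_eq_SUP
proof (rule cSUP_upper)
  show "bdd_above (\<nu> ` {K. compact K \<and> K \<subseteq> B})"
    by (rule bdd_aboveI[of _ "\<nu> UNIV"])
      (auto intro!: sigma_maxitive_mono[OF optimal_sigma_maxitive] intro: compact_in_borel)
qed (use assms in auto)

lemma regular_part_least:
  assumes "\<And>K. compact K \<Longrightarrow> K \<subseteq> B \<Longrightarrow> \<nu> K \<le> z"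
  shows "regular_part \<nu> B \<le> z"
  unfolding regular_part_eq_SUP by (rule cSUP_least) (use assms in auto)

lemma regular_part_mono: "A \<subseteq> B \<Longrightarrow> regular_part \<nu> A \<le> regular_part \<nu> B"
  by (rule regular_part_least) (auto intro: regular_part_upper)

lemma regular_part_le: "B \<in> sets borel \<Longrightarrow> regular_part \<nu> B \<le> \<nu> B"
  by (rule regular_part_least)
    (auto intro!: sigma_maxitive_mono[OF optimal_sigma_maxitive] intro: compact_in_borel)

text \<open>Closed subsets of \<open>B\<close> are closed in the compact \<open>K\<close>, hence
  compact, so approximation by closed sets becomes approximation by compact ones.\<close>

lemma le_regular_part_of_subset_compact:
  assumes "B \<in> sets borel" "compact K" "B \<subseteq> K"
  shows "\<nu> B \<le> regular_part \<nu> B"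
proof (rule optimal_le_if_closed_le[OF assms(1)])
  fix F assume "closed F" "F \<subseteq> B"
  moreover from this have "compact F"
    using closed_Int_compact[of F K] assms by (simp add: inf_absorb1)
  ultimately show "\<nu> F \<le> regular_part \<nu> B" by (intro regular_part_upper)
qed

text \<open>A compact \<open>K\<close> inside the union is cut into the pieces
  \<open>K \<inter> A\<close>. They may fail to be compact, but they are Borel subsets of
  \<open>K\<close>, where \<open>\<nu>\<close> and its regular part agree.\<close>

lemma sigma_maxitive_regular_part: "sigma_maxitive_measure (regular_part \<nu>)"
proof (rule sigma_maxitiveI)
  show "regular_part \<nu> {} = bot"
    using regular_part_le[of "{}"] optimal_sigma_maxitive
    by (simp add: sigma_maxitive_measure_def bot_unique)
next
  fix \<A> :: "'e set set" and z
  assume \<A>: "countable \<A>" "\<A> \<subseteq> sets borel" and z: "\<And>A. A \<in> \<A> \<Longrightarrow> regular_part \<nu> A \<le> z"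
  show "regular_part \<nu> (\<Union>\<A>) \<le> z"
  proof (rule regular_part_least)
    fix K assume K: "compact K" "K \<subseteq> \<Union>\<A>"
    then have "K = \<Union>((\<lambda>A. K \<inter> A) ` \<A>)" by auto
    moreover have "\<nu> (\<Union>((\<lambda>A. K \<inter> A) ` \<A>)) \<le> z"
    proof (rule sigma_maxitive_Union_le[OF optimal_sigma_maxitive])
      fix B assume "B \<in> (\<lambda>A. K \<inter> A) ` \<A>"
      then obtain A where A: "A \<in> \<A>" "B = K \<inter> A" by auto
      have "\<nu> B \<le> regular_part \<nu> B"
        using A \<A> K compact_in_borel by (intro le_regular_part_of_subset_compact[of _ K]) auto
      also have "\<dots> \<le> regular_part \<nu> A" using A by (intro regular_part_mono) auto
      also have "\<dots> \<le> z" using z A by auto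
      finally show "\<nu> B \<le> z" .
    qed (use \<A> K compact_in_borel in auto)
    ultimately show "\<nu> K \<le> z" by simp
  qed
qed (rule regular_part_mono)

lemma optimal_regular_part: "optimal_measure (regular_part \<nu>)"
  using optimal_measure_of_dominated[OF continuous optimal sigma_maxitive_regular_part]
    regular_part_le by blast

lemma regular_part_compact: "compact K \<Longrightarrow> regular_part \<nu> K = \<nu> K"
  by (rule antisym[OF regular_part_le[OF compact_in_borel] regular_part_upper]) auto

end

text \<open>The regular part equals \<open>\<nu>\<close> on compact sets, so inner regularity
  restates its construction. Outer regularity is \<open>outer_part_optimal\<close> applied to the
  regular part itself, which is optimal; hence the statement stands outside the context fixing
  \<open>\<nu>\<close>.\<close>

lemma regular_regular_part:
  fixes \<nu> :: "'e::topological_space set \<Rightarrow> 'l::{conditionally_complete_lattice, order_bot}"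
  assumes "continuous_poset TYPE('l)" "metrizable_space (euclidean :: 'e topology)"
    "optimal_measure \<nu>"
  shows "regular_measure (regular_part \<nu>)"
  unfolding regular_measure_def isLub_UNIV_iff
proof (intro ballI conjI allI impI)
  fix B :: "'e set" and z
  assume "\<forall>x\<in>regular_part \<nu> ` {K. compact K \<and> K \<subseteq> B}. x \<le> z"
  then show "regular_part \<nu> B \<le> z"
    by (intro regular_part_least[OF assms]) (auto simp: regular_part_compact[OF assms])
qed (auto simp: outer_part_optimal[OF assms(1,2) optimal_regular_part[OF assms]]
  intro: regular_part_mono[OF assms])

section \<open>The singular part\<close>

text \<open>The difference of \<open>\<nu>\<close> and \<open>\<rho>\<close> can drop when a set
  grows, so its monotone hull is taken. The value \<open>bot\<close> off the Borel sets makes it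
  least among total functions.\<close>

definition maxitive_excess ::
    "('e::topological_space set \<Rightarrow> 'l::{conditionally_complete_lattice, order_bot})
      \<Rightarrow> ('e set \<Rightarrow> 'l) \<Rightarrow> 'e set \<Rightarrow> 'l" where
  "maxitive_excess \<nu> \<rho> B = (if B \<in> sets borel
     then SUP C\<in>{C \<in> sets borel. C \<subseteq> B}. relative_difference (\<nu> C) (\<rho> C) else bot)"

lemma maxitive_excess_least:
  assumes "\<And>C. C \<in> sets borel \<Longrightarrow> C \<subseteq> B \<Longrightarrow> \<nu> C \<le> sup (\<rho> C) z"
  shows "maxitive_excess \<nu> \<rho> B \<le> z"
  unfolding maxitive_excess_def
  by (auto intro!: cSUP_least relative_difference_le assms)

text \<open>All differences involved are bounded by \<open>\<nu> B\<close>, so the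
  \<open>SUP\<close> is a true supremum.\<close>

lemma relative_difference_le_maxitive_excess:
  assumes \<nu>: "maxitive_measure \<nu>" and "C \<in> sets borel" "B \<in> sets borel" "C \<subseteq> B"
  shows "relative_difference (\<nu> C) (\<rho> C) \<le> maxitive_excess \<nu> \<rho> B"
proof -
  have "relative_difference (\<nu> D) (\<rho> D) \<le> \<nu> B" if "D \<in> sets borel" "D \<subseteq> B" for D
    using maxitive_measure_mono[OF \<nu>, of D B] that assms
    by (intro relative_difference_le) (auto intro: le_supI2)
  then have "bdd_above ((\<lambda>C. relative_difference (\<nu> C) (\<rho> C)) ` {C \<in> sets borel. C \<subseteq> B})"
    by (intro bdd_aboveI[of _ "\<nu> B"]) auto
  then show ?thesis
    unfolding maxitive_excess_def using assms by (auto intro!: cSUP_upper)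
qed

context
  fixes \<nu> \<rho> :: "'e::topological_space set
    \<Rightarrow> 'l::{conditionally_complete_lattice, distrib_lattice, order_bot}"
  assumes continuous: "continuous_poset TYPE('l)"
    and sigma_maxitive: "sigma_maxitive_measure \<nu>"
    and mono: "\<And>A B. A \<in> sets borel \<Longrightarrow> B \<in> sets borel \<Longrightarrow> A \<subseteq> B \<Longrightarrow> \<rho> A \<le> \<rho> B"
begin

text \<open>Keeping \<open>\<rho>\<close> at \<open>C\<close> but the excess at \<open>B\<close>
  matches the premise of \<open>maxitive_excess_least\<close>, which yields monotonicity at
  once.\<close>

lemma le_sup_maxitive_excess:
  assumes "C \<in> sets borel" "B \<in> sets borel" "C \<subseteq> B"
  shows "\<nu> C \<le> sup (\<rho> C) (maxitive_excess \<nu> \<rho> B)"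
  using le_sup_relative_difference[OF continuous, of "\<nu> C" "\<rho> C"]
    relative_difference_le_maxitive_excess[OF sigma_maxitive_imp_maxitive[OF sigma_maxitive] assms]
  by (meson order_trans sup_mono order_refl)

lemma maxitive_excess_le:
  assumes "B \<in> sets borel"
  shows "maxitive_excess \<nu> \<rho> B \<le> \<nu> B"
  by (rule maxitive_excess_least)
    (auto intro!: le_supI2 sigma_maxitive_mono[OF sigma_maxitive] assms)

text \<open>For \<open>C\<close> inside the union, each piece \<open>C \<inter> A\<close> has value
  at most \<open>\<rho> (C \<inter> A)\<close> joined with the excess of \<open>A\<close>, hence at
  most \<open>sup (\<rho> C) z\<close>; \<open>\<sigma>\<close>-maxitivity of \<open>\<nu>\<close>
  reassembles \<open>C\<close>.\<close>

lemma sigma_maxitive_excess: "sigma_maxitive_measure (maxitive_excess \<nu> \<rho>)"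
proof (rule sigma_maxitiveI)
  show "maxitive_excess \<nu> \<rho> {} = bot"
    using maxitive_excess_le[of "{}"] sigma_maxitive
    by (simp add: sigma_maxitive_measure_def bot_unique)
next
  fix A B :: "'e set" assume "A \<in> sets borel" "B \<in> sets borel" "A \<subseteq> B"
  then show "maxitive_excess \<nu> \<rho> A \<le> maxitive_excess \<nu> \<rho> B"
    by (intro maxitive_excess_least le_sup_maxitive_excess) auto
next
  fix \<A> :: "'e set set" and z
  assume \<A>: "countable \<A>" "\<A> \<subseteq> sets borel" and z: "\<And>A. A \<in> \<A> \<Longrightarrow> maxitive_excess \<nu> \<rho> A \<le> z"
  show "maxitive_excess \<nu> \<rho> (\<Union>\<A>) \<le> z"
  proof (rule maxitive_excess_least)
    fix C assume C: "C \<in> sets borel" "C \<subseteq> \<Union>\<A>"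
    then have "C = \<Union>((\<lambda>A. C \<inter> A) ` \<A>)" by auto
    moreover have "\<nu> (\<Union>((\<lambda>A. C \<inter> A) ` \<A>)) \<le> sup (\<rho> C) z"
    proof (rule sigma_maxitive_Union_le[OF sigma_maxitive])
      fix D assume "D \<in> (\<lambda>A. C \<inter> A) ` \<A>"
      then obtain A where A: "A \<in> \<A>" "D = C \<inter> A" by auto
      then have "\<nu> D \<le> sup (\<rho> D) (maxitive_excess \<nu> \<rho> A)"
        using C \<A> by (intro le_sup_maxitive_excess) auto
      also have "\<dots> \<le> sup (\<rho> C) z"
        using A C \<A> by (intro sup_mono mono z) auto
      finally show "\<nu> D \<le> sup (\<rho> C) z" .
    qed (use C \<A> in auto)
    ultimately show "\<nu> C \<le> sup (\<rho> C) z" by simp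
  qed
qed

text \<open>For minimality, a competitor \<open>\<tau>\<close> is monotone on Borel sets, so
  \<open>\<nu> C = sup (\<rho> C) (\<tau> C) \<le> sup (\<rho> C) (\<tau> B)\<close> whenever
  \<open>C \<subseteq> B\<close>, which bounds the excess at \<open>B\<close> by
  \<open>\<tau> B\<close>.\<close>

lemma Least_maxitive_complement:
  assumes le: "\<And>B. B \<in> sets borel \<Longrightarrow> \<rho> B \<le> \<nu> B"
  shows "(LEAST \<tau>. maxitive_measure \<tau> \<and> (\<forall>B\<in>sets borel. \<nu> B = sup (\<rho> B) (\<tau> B)))
    = maxitive_excess \<nu> \<rho>"
proof (rule Least_equality, intro conjI ballI)
  show "maxitive_measure (maxitive_excess \<nu> \<rho>)"
    by (rule sigma_maxitive_imp_maxitive[OF sigma_maxitive_excess])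
next
  fix B :: "'e set" assume "B \<in> sets borel"
  then show "\<nu> B = sup (\<rho> B) (maxitive_excess \<nu> \<rho> B)"
    by (intro antisym le_sup_maxitive_excess le_supI le maxitive_excess_le) auto
next
  fix \<tau> :: "'e set \<Rightarrow> 'l"
  assume \<tau>: "maxitive_measure \<tau> \<and> (\<forall>B\<in>sets borel. \<nu> B = sup (\<rho> B) (\<tau> B))"
  show "maxitive_excess \<nu> \<rho> \<le> \<tau>"
  proof (rule le_funI)
    fix B :: "'e set"
    show "maxitive_excess \<nu> \<rho> B \<le> \<tau> B"
    proof (cases "B \<in> sets borel")
      case True
      with \<tau> show ?thesis
        by (intro maxitive_excess_least) (auto intro!: le_supI2 maxitive_measure_mono)
    qed (simp add: maxitive_excess_def)
  qed
qed

end

theorem corollary5p6: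
  fixes \<nu> :: "'e::topological_space set
    \<Rightarrow> 'l::{conditionally_complete_lattice, distrib_lattice, order_bot}"
  assumes "continuous_poset TYPE('l)"
    and "metrizable_space (euclidean :: 'e topology)"
    and "optimal_measure \<nu>"
  shows "(\<forall>B\<in>sets borel. \<nu> B = sup (regular_part \<nu> B) (singular_part \<nu> B))
    \<and> regular_measure (regular_part \<nu>) \<and> optimal_measure (regular_part \<nu>)
    \<and> optimal_measure (singular_part \<nu>)
    \<and> (\<forall>K. compact K \<longrightarrow> singular_part \<nu> K = bot)"
proof -
  note \<nu> = optimal_sigma_maxitive[OF assms]
  note \<rho>_mono = regular_part_mono[OF assms]
  note \<rho>_le = regular_part_le[OF assms]
  \<comment> \<open>Since the outer part of \<open>\<nu>\<close> is \<open>\<nu>\<close> on Borel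
    sets, the defining equation becomes a decomposition of \<open>\<nu>\<close> itself.\<close>
  have "singular_part \<nu> = (LEAST \<tau>. maxitive_measure \<tau>
     \<and> (\<forall>B\<in>sets borel. \<nu> B = sup (regular_part \<nu> B) (\<tau> B)))"
    unfolding singular_part_def by (simp add: outer_part_optimal[OF assms] cong: ball_cong)
  also have "\<dots> = maxitive_excess \<nu> (regular_part \<nu>)"
    by (rule Least_maxitive_complement[OF assms(1) \<nu> \<rho>_mono \<rho>_le])
  finally have singular: "singular_part \<nu> = maxitive_excess \<nu> (regular_part \<nu>)" .
  have "\<nu> B = sup (regular_part \<nu> B) (singular_part \<nu> B)" if "B \<in> sets borel" for B
    unfolding singular using that
    by (intro antisym le_sup_maxitive_excess[OF assms(1) \<nu> \<rho>_mono] le_supI \<rho>_le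
        maxitive_excess_le[OF assms(1) \<nu> \<rho>_mono]) auto
  moreover have "optimal_measure (singular_part \<nu>)"
    unfolding singular
    by (rule optimal_measure_of_dominated[OF assms(1,3) sigma_maxitive_excess[OF assms(1) \<nu> \<rho>_mono]
          maxitive_excess_le[OF assms(1) \<nu> \<rho>_mono]])
  moreover have "singular_part \<nu> K = bot" if "compact K" for K
  proof -
    have "singular_part \<nu> K \<le> bot"
      \<comment> \<open>On every Borel \<open>C \<subseteq> K\<close> the regular part already
        dominates \<open>\<nu>\<close>, so \<open>bot\<close> is an admissible remainder.\<close>
      unfolding singular using le_regular_part_of_subset_compact[OF assms _ that]
      by (intro maxitive_excess_least le_supI1) simp
    then show ?thesis by (rule bot_unique[THEN iffD1])
  qed
  ultimately show ?thesis
    using regular_regular_part[OF assms] optimal_regular_part[OF assms] by blast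
qed

end
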